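(* Let $R$ be a commutative ring with $1$, let $A$ be an $n\times n$ matrix with entries in $R$ such that $A_{ii}=2$ for all $1\leq i\leq n$, and let $\pi$ be a permutation of $\{1,2,\dots,n\}$. Then $$r^A_{\pi(1)}r^A_{\pi(2)}\cdots r^A_{\pi(n)}=-A_{\pi,+}^{-1}A_{\pi,-}^t.$$
   Context: Here $2$ means $1+1$ in $R$. Let $e_1,\dots,e_n$ be the standard basis of $R^n$ (column vectors); matrices act on the left and $M^t$ denotes the transpose of $M$. For $1\le i\le n$ the reflection $r_i^A$ is the $R$-linear map (matrix) defined by $r_i^A(e_j)=e_j-A_{ij}e_i$ for $1\leq j\leq n$. The $n\times n$ matrices $A_{\pi,+}$ and $A_{\pi,-}$ are defined by: $(A_{\pi,+})_{ij}=A_{ij}$ if $\pi^{-1}(i)<\pi^{-1}(j)$, $1$ if $i=j$, and $0$ otherwise; and $(A_{\pi,-})_{ij}=A_{ji}$ if $\pi^{-1}(i)<\pi^{-1}(j)$, $1$ if $i=j$, and $0$ otherwise. *)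

theory Defs
  imports
    "Jordan_Normal_Form.Matrix"
    "HOL-Combinatorics.Permutations"
begin

text \<open>
  Entries lie in a type of sort \<open>{comm_ring, comm_monoid_mult}\<close>: a commutative ring with 1.
  The class \<open>comm_ring_1\<close> additionally requires \<open>0 \<noteq> 1\<close> and so excludes the zero ring.
  For the same reason the standard basis and the two-sided inverse are spelled out here:
  \<open>unit_vec\<close>, \<open>inverts_mat\<close> and \<open>invertible_mat\<close> are restricted to types with \<open>0 \<noteq> 1\<close>.

  Indices run over \<open>{0..<n}\<close> instead of \<open>{1..n}\<close>; only their order matters.
\<close>

definition is_inverse_mat ::
  "'a::{comm_ring, comm_monoid_mult} mat \<Rightarrow> 'a mat \<Rightarrow> bool" where
  "is_inverse_mat A B \<longleftrightarrow>
     (\<exists>n. A \<in> carrier_mat n n \<and> B \<in> carrier_mat n n \<and> A * B = 1\<^sub>m n \<and> B * A = 1\<^sub>m n)"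

text \<open>Meaningful only if a two-sided inverse exists; it is then unique (see below).\<close>

definition inverse_mat :: "'a::{comm_ring, comm_monoid_mult} mat \<Rightarrow> 'a mat" where
  "inverse_mat A = (THE B. is_inverse_mat A B)"

definition std_basis_vec :: "nat \<Rightarrow> nat \<Rightarrow> 'a::{comm_ring, comm_monoid_mult} vec" where
  "std_basis_vec n i = vec n (\<lambda>k. if k = i then 1 else 0)"

text \<open>Column \<open>j\<close> is the image of the \<open>j\<close>-th standard basis vector.\<close>

definition reflection_mat :: "'a::{comm_ring, comm_monoid_mult} mat \<Rightarrow> nat \<Rightarrow> 'a mat" where
  "reflection_mat A i =
     (let n = dim_row A in
      mat_of_cols n (map (\<lambda>j. std_basis_vec n j - A $$ (i, j) \<cdot>\<^sub>v std_basis_vec n i) [0..<n]))"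

definition perm_plus_mat ::
  "(nat \<Rightarrow> nat) \<Rightarrow> 'a::{comm_ring, comm_monoid_mult} mat \<Rightarrow> 'a mat" where
  "perm_plus_mat \<pi> A = mat (dim_row A) (dim_row A)
     (\<lambda>(i, j). if inv_into UNIV \<pi> i < inv_into UNIV \<pi> j then A $$ (i, j) else if i = j then 1 else 0)"

definition perm_minus_mat ::
  "(nat \<Rightarrow> nat) \<Rightarrow> 'a::{comm_ring, comm_monoid_mult} mat \<Rightarrow> 'a mat" where
  "perm_minus_mat \<pi> A = mat (dim_row A) (dim_row A)
     (\<lambda>(i, j). if inv_into UNIV \<pi> i < inv_into UNIV \<pi> j then A $$ (j, i) else if i = j then 1 else 0)"

text \<open>The product \<open>f 0 * f 1 * \<dots> * f (n - 1)\<close> of \<open>n \<times> n\<close> matrices, in this order.\<close>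

definition ordered_prod_mat ::
  "nat \<Rightarrow> (nat \<Rightarrow> 'a::{comm_ring, comm_monoid_mult} mat) \<Rightarrow> 'a mat" where
  "ordered_prod_mat n f = foldr (\<lambda>k M. f k * M) [0..<n] (1\<^sub>m n)"

lemma one_mat_mult_left:
  fixes A :: "'a::{comm_ring, comm_monoid_mult} mat"
  assumes "A \<in> carrier_mat n m"
  shows "1\<^sub>m n * A = A"
proof (rule eq_matI)
  fix i j assume ij: "i < dim_row A" "j < dim_col A"
  have "(1\<^sub>m n * A) $$ (i, j) = (\<Sum>k\<in>{0..<n}. (if i = k then 1 else 0) * A $$ (k, j))"
    using assms ij by (auto simp: scalar_prod_def intro!: sum.cong)
  also have "\<dots> = (\<Sum>k\<in>{0..<n}. if i = k then A $$ (k, j) else 0)"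
    by (rule sum.cong) auto
  also have "\<dots> = A $$ (i, j)"
    using assms ij by (simp add: sum.delta)
  finally show "(1\<^sub>m n * A) $$ (i, j) = A $$ (i, j)" .
qed (use assms in auto)

lemma one_mat_mult_right:
  fixes A :: "'a::{comm_ring, comm_monoid_mult} mat"
  assumes "A \<in> carrier_mat m n"
  shows "A * 1\<^sub>m n = A"
proof (rule eq_matI)
  fix i j assume ij: "i < dim_row A" "j < dim_col A"
  have "(A * 1\<^sub>m n) $$ (i, j) = (\<Sum>k\<in>{0..<n}. A $$ (i, k) * (if k = j then 1 else 0))"
    using assms ij by (auto simp: scalar_prod_def intro!: sum.cong)
  also have "\<dots> = (\<Sum>k\<in>{0..<n}. if k = j then A $$ (i, k) else 0)"
    by (rule sum.cong) auto
  also have "\<dots> = A $$ (i, j)"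
    using assms ij by (simp add: sum.delta)
  finally show "(A * 1\<^sub>m n) $$ (i, j) = A $$ (i, j)" .
qed (use assms in auto)

lemma is_inverse_mat_unique:
  assumes "is_inverse_mat A B" "is_inverse_mat A C"
  shows "B = C"
proof -
  from assms obtain n where A: "A \<in> carrier_mat n n" and B: "B \<in> carrier_mat n n"
    and C: "C \<in> carrier_mat n n" and BA: "B * A = 1\<^sub>m n" and AC: "A * C = 1\<^sub>m n"
    unfolding is_inverse_mat_def by (metis carrier_matD(1))
  have "B = B * (A * C)" using AC one_mat_mult_right[OF B] by simp
  also have "\<dots> = B * A * C" using A B C by (simp add: assoc_mult_mat)
  also have "\<dots> = C" using BA one_mat_mult_left[OF C] by simp
  finally show ?thesis .
qed

lemma inverse_mat_eqI: "is_inverse_mat A B \<Longrightarrow> inverse_mat A = B"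
  unfolding inverse_mat_def using is_inverse_mat_unique by blast

end

theory Submission
  imports Defs
begin

text \<open>
  Left multiplication by \<open>r\<^sub>i = 1 - e\<^sub>i e\<^sub>i\<^sup>t A\<close> changes only row \<open>i\<close>. Hence, if \<open>P\<close> is the product of
  the reflections, the partial product to the right of \<open>r\<^sub>i\<close> agrees with \<open>P\<close> in the rows after \<open>i\<close>
  (in the order given by \<open>\<pi>\<close>) and with the identity in the others. Reading off row \<open>i\<close> of \<open>P\<close> gives
  \<open>A\<^sub>+ P = 1 - (A - (A\<^sub>+ - 1))\<close>, which is \<open>-A\<^sub>-\<^sup>t\<close> if the diagonal of \<open>A\<close> is \<open>2\<close>. The same identity
  with \<open>A\<^sub>+ - 1\<close> in place of \<open>A\<close> reads \<open>A\<^sub>+ Q = 1\<close>; each factor of \<open>Q\<close> has a right inverse because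
  \<open>A\<^sub>+ - 1\<close> has zero diagonal, so \<open>A\<^sub>+\<close> is invertible.
\<close>

lemma reflection_mat_carrier [simp]:
  "A \<in> carrier_mat n n \<Longrightarrow> reflection_mat A i \<in> carrier_mat n n"
  by (auto simp: reflection_mat_def Let_def)

lemma reflection_mat_dim [simp]:
  "dim_row (reflection_mat A i) = dim_row A" "dim_col (reflection_mat A i) = dim_row A"
  by (auto simp: reflection_mat_def Let_def)

lemma reflection_mat_index:
  assumes "A \<in> carrier_mat n n" "i < n" "r < n" "c < n"
  shows "reflection_mat A i $$ (r, c) =
    (if r = c then 1 else 0) - (if r = i then A $$ (i, c) else 0)"
  using assms by (auto simp: reflection_mat_def Let_def mat_of_cols_index std_basis_vec_def)

lemma reflection_mat_mult_index:
  fixes A M :: "'a::{comm_ring, comm_monoid_mult} mat"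
  assumes "A \<in> carrier_mat n n" "M \<in> carrier_mat n m" "i < n" "r < n" "c < m"
  shows "(reflection_mat A i * M) $$ (r, c) =
    M $$ (r, c) - (if r = i then \<Sum>j<n. A $$ (i, j) * M $$ (j, c) else 0)"
proof -
  have "(reflection_mat A i * M) $$ (r, c) =
      (\<Sum>j<n. reflection_mat A i $$ (r, j) * M $$ (j, c))"
    using assms
    by (auto simp: scalar_prod_def lessThan_atLeast0 intro!: sum.cong)
  also have "\<dots> = (\<Sum>j<n. (if r = j then M $$ (j, c) else 0)
      - (if r = i then A $$ (i, j) * M $$ (j, c) else 0))"
    using assms by (intro sum.cong) (auto simp: reflection_mat_index algebra_simps)
  also have "\<dots> = M $$ (r, c) - (if r = i then \<Sum>j<n. A $$ (i, j) * M $$ (j, c) else 0)"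
    using assms by (simp add: sum_subtractf)
  finally show ?thesis .
qed

text \<open>For \<open>E\<close> = e_i e_i^t A one has E^2 = A_ii E, which vanishes here, so (1 -
  E)(1 + E) = 1.\<close>

lemma reflection_mat_mult_uminus:
  fixes A :: "'a::{comm_ring, comm_monoid_mult} mat"
  assumes A: "A \<in> carrier_mat n n" and i: "i < n" and 0: "A $$ (i, i) = 0"
  shows "reflection_mat A i * reflection_mat (- A) i = 1\<^sub>m n"
proof (rule eq_matI)
  have B: "- A \<in> carrier_mat n n" using A by simp
  fix r c assume "r < dim_row (1\<^sub>m n :: 'a mat)" "c < dim_col (1\<^sub>m n :: 'a mat)"
  hence rc: "r < n" "c < n" by auto
  have "(\<Sum>j<n. A $$ (i, j) * reflection_mat (- A) i $$ (j, c)) =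
      (\<Sum>j<n. (if j = c then A $$ (i, j) else 0)
        + (if j = i then A $$ (i, i) * A $$ (i, c) else 0))"
    using A i rc by (intro sum.cong) (auto simp: reflection_mat_index[OF B] algebra_simps)
  also have "\<dots> = A $$ (i, c)"
    using i rc 0 by (simp add: sum.distrib)
  finally show "(reflection_mat A i * reflection_mat (- A) i) $$ (r, c) = 1\<^sub>m n $$ (r, c)"
    unfolding reflection_mat_mult_index[OF A reflection_mat_carrier[OF B] i rc]
    using A i rc by (auto simp: reflection_mat_index[OF B])
qed (use A in auto)

text \<open>The start index is a parameter so that downward induction on \<open>k\<close> can peel
  off the leftmost factor.\<close>

definition suffix_prod_mat ::
  "nat \<Rightarrow> (nat \<Rightarrow> 'a::{comm_ring, comm_monoid_mult} mat) \<Rightarrow> nat \<Rightarrow> 'a mat" where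
  "suffix_prod_mat n f k = foldr (\<lambda>k M. f k * M) [k..<n] (1\<^sub>m n)"

lemma suffix_prod_mat_self [simp]: "suffix_prod_mat n f n = 1\<^sub>m n"
  by (simp add: suffix_prod_mat_def)

lemma suffix_prod_mat_step: "k < n \<Longrightarrow> suffix_prod_mat n f k = f k * suffix_prod_mat n f (Suc k)"
  by (simp add: suffix_prod_mat_def upt_conv_Cons)

lemma suffix_prod_mat_0: "suffix_prod_mat n f 0 = ordered_prod_mat n f"
  by (simp add: suffix_prod_mat_def ordered_prod_mat_def)

lemma suffix_prod_mat_carrier:
  assumes "k \<le> n" "\<And>k. k < n \<Longrightarrow> f k \<in> carrier_mat n n"
  shows "suffix_prod_mat n f k \<in> carrier_mat n n"
  using assms(1)
proof (induction k rule: inc_induct)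
  case (step k)
  thus ?case using mult_carrier_mat[OF assms(2)] by (simp add: suffix_prod_mat_step)
qed simp

text \<open>Right inverses multiply in reverse order: putting \<open>f k\<close> on the left of the
  product puts \<open>g k\<close> on the right of \<open>Y\<close>.\<close>

lemma suffix_prod_mat_right_inverse:
  assumes "k \<le> n" and f: "\<And>k. k < n \<Longrightarrow> f k \<in> carrier_mat n n"
    and g: "\<And>k. k < n \<Longrightarrow> g k \<in> carrier_mat n n" "\<And>k. k < n \<Longrightarrow> f k * g k = 1\<^sub>m n"
  shows "\<exists>Y \<in> carrier_mat n n. suffix_prod_mat n f k * Y = 1\<^sub>m n"
  using assms(1)
proof (induction k rule: inc_induct)
  case base
  show ?case using one_mat_mult_left[of "1\<^sub>m n" n n] by (intro bexI[of _ "1\<^sub>m n"]) auto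
next
  case (step k)
  let ?S = "suffix_prod_mat n f (Suc k)"
  obtain Y where Y: "Y \<in> carrier_mat n n" "?S * Y = 1\<^sub>m n"
    using step by blast
  have k: "k < n" and S: "?S \<in> carrier_mat n n"
    using step suffix_prod_mat_carrier[of "Suc k" n f] f by auto
  note gk = g(1)[OF k] and fk = f[OF k]
  have "f k * ?S * (Y * g k) = f k * (?S * (Y * g k))"
    using assoc_mult_mat[OF fk S mult_carrier_mat[OF Y(1) gk]] .
  also have "?S * (Y * g k) = ?S * Y * g k"
    using assoc_mult_mat[OF S Y(1) gk] by simp
  also have "f k * \<dots> = 1\<^sub>m n"
    using Y(2) one_mat_mult_left[OF gk] g(2)[OF k] by simp
  finally show ?case
    using Y gk k by (intro bexI[of _ "Y * g k"]) (auto simp: suffix_prod_mat_step)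
qed

text \<open>The diagonal of \<open>A\<close> is left free because the locale serves twice: for the
  matrix of the theorem, and for a matrix with zero diagonal when
  \<open>perm_plus_mat \<pi> A\<close> is inverted.\<close>

locale ordered_reflections =
  fixes A :: "'a::{comm_ring, comm_monoid_mult} mat" and n :: nat and \<pi> :: "nat \<Rightarrow> nat"
  assumes A: "A \<in> carrier_mat n n" and perm: "\<pi> permutes {0..<n}"
begin

definition partial_prod :: "nat \<Rightarrow> 'a mat" where
  "partial_prod = suffix_prod_mat n (\<lambda>k. reflection_mat A (\<pi> k))"

lemma perm_less [simp]: "\<pi> k < n \<longleftrightarrow> k < n" "inv_into UNIV \<pi> k < n \<longleftrightarrow> k < n"
  using permutes_in_image[OF perm, of k] permutes_in_image[OF permutes_inv[OF perm], of k] by auto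

lemma inv_eq_iff: "inv_into UNIV \<pi> i = k \<longleftrightarrow> i = \<pi> k"
  by (metis permutes_inv_eq[OF perm])

lemma partial_prod_carrier: "k \<le> n \<Longrightarrow> partial_prod k \<in> carrier_mat n n"
  unfolding partial_prod_def using A by (intro suffix_prod_mat_carrier) auto

lemma partial_prod_step_index:
  assumes "k < n" "i < n" "c < n"
  shows "partial_prod k $$ (i, c) = partial_prod (Suc k) $$ (i, c) -
    (if inv_into UNIV \<pi> i = k then \<Sum>j<n. A $$ (i, j) * partial_prod (Suc k) $$ (j, c) else 0)"
  using assms partial_prod_carrier[of "Suc k"] reflection_mat_mult_index[OF A, of _ n "\<pi> k" i c]
  by (auto simp: partial_prod_def suffix_prod_mat_step inv_eq_iff)

text \<open>Call \<open>inv_into UNIV \<pi> i\<close> the position of \<open>i\<close>. Row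
  \<open>i\<close> is altered only by the factor at its own position, which is absent from the
  partial product.\<close>

lemma partial_prod_index_less:
  assumes "k \<le> n" "inv_into UNIV \<pi> i < k" "i < n" "c < n"
  shows "partial_prod k $$ (i, c) = (if i = c then 1 else 0)"
  using assms
proof (induction k rule: inc_induct)
  case base
  thus ?case by (simp add: partial_prod_def)
qed (simp add: partial_prod_step_index)

text \<open>The factors at positions below \<open>k\<close>, which are still to be multiplied on the
  left, alter only rows at those positions.\<close>

lemma partial_prod_index_ge:
  assumes "k \<le> inv_into UNIV \<pi> i" "i < n" "c < n"
  shows "partial_prod k $$ (i, c) = partial_prod 0 $$ (i, c)"
  using assms
proof (induction k)
  case (Suc k)
  moreover from Suc.prems have "k < n" by (metis Suc_le_lessD less_trans perm_less(2))
  ultimately show ?case using partial_prod_step_index[of k i c] by simp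
qed simp

text \<open>The \<open>\<le>\<close> includes \<open>c = i\<close>, so the diagonal of
  \<open>A\<close> enters here: diagonal \<open>1 + 1\<close> yields -1, diagonal \<open>0\<close>
  yields 1.\<close>

lemma perm_plus_mat_mult_prod_index:
  assumes ic: "i < n" "c < n"
  shows "(perm_plus_mat \<pi> A * ordered_prod_mat n (\<lambda>k. reflection_mat A (\<pi> k))) $$ (i, c) =
    (if i = c then 1 else 0) - (if inv_into UNIV \<pi> c \<le> inv_into UNIV \<pi> i then A $$ (i, c) else 0)"
proof -
  let ?P = "partial_prod 0"
  let ?later = "\<Sum>j<n. if inv_into UNIV \<pi> i < inv_into UNIV \<pi> j then A $$ (i, j) * ?P $$ (j, c) else 0"
  \<comment> \<open>To the right of the factor for \<open>i\<close>, rows up to the position of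
    \<open>i\<close> are still identity rows, so only \<open>j = c\<close> contributes among them;
    later rows are already those of \<open>?P\<close>.\<close>
  have "(\<Sum>j<n. A $$ (i, j) * partial_prod (Suc (inv_into UNIV \<pi> i)) $$ (j, c)) =
      (\<Sum>j<n. (if j = c then if inv_into UNIV \<pi> c \<le> inv_into UNIV \<pi> i then A $$ (i, c) else 0 else 0)
        + (if inv_into UNIV \<pi> i < inv_into UNIV \<pi> j then A $$ (i, j) * ?P $$ (j, c) else 0))"
  proof (rule sum.cong, goal_cases)
    case (2 j)
    have "Suc (inv_into UNIV \<pi> i) \<le> n" using ic by (simp add: Suc_le_eq)
    thus ?case
      using 2 ic partial_prod_index_less[of "Suc (inv_into UNIV \<pi> i)" j c]
        partial_prod_index_ge[of "Suc (inv_into UNIV \<pi> i)" j c]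
      by (cases "inv_into UNIV \<pi> i < inv_into UNIV \<pi> j") auto
  qed simp
  also have "\<dots> = (if inv_into UNIV \<pi> c \<le> inv_into UNIV \<pi> i then A $$ (i, c) else 0) + ?later"
    using ic by (simp add: sum.distrib)
  \<comment> \<open>The factor for \<open>i\<close> turns the identity row \<open>i\<close> into its
    final form.\<close>
  finally have *: "?P $$ (i, c) = (if i = c then 1 else 0) -
      ((if inv_into UNIV \<pi> c \<le> inv_into UNIV \<pi> i then A $$ (i, c) else 0) + ?later)"
    using ic partial_prod_index_ge[of "inv_into UNIV \<pi> i" i c] partial_prod_step_index[of "inv_into UNIV \<pi> i" i c]
      partial_prod_index_less[of "Suc (inv_into UNIV \<pi> i)" i c] by (simp add: Suc_le_eq)
  have "(perm_plus_mat \<pi> A * ?P) $$ (i, c) = (\<Sum>j<n. perm_plus_mat \<pi> A $$ (i, j) * ?P $$ (j, c))"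
    using ic A partial_prod_carrier[of 0]
    by (auto simp: scalar_prod_def lessThan_atLeast0 perm_plus_mat_def intro!: sum.cong)
  \<comment> \<open>Split off the unit diagonal of \<open>perm_plus_mat \<pi> A\<close>; the
    remaining sum is \<open>?later\<close>, which cancels against its negative in
    \<open>*\<close>.\<close>
  also have "\<dots> = (\<Sum>j<n. (if i = j then ?P $$ (j, c) else 0)
      + (if inv_into UNIV \<pi> i < inv_into UNIV \<pi> j then A $$ (i, j) * ?P $$ (j, c) else 0))"
    using ic A by (intro sum.cong) (auto simp: perm_plus_mat_def)
  also have "\<dots> = ?P $$ (i, c) + ?later"
    using ic by (simp add: sum.distrib)
  finally show ?thesis
    using * by (simp add: partial_prod_def suffix_prod_mat_0)
qed

end

lemma perm_plus_mat_carrier: "A \<in> carrier_mat n n \<Longrightarrow> perm_plus_mat \<pi> A \<in> carrier_mat n n"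
  by (simp add: perm_plus_mat_def)

lemma perm_plus_mat_invertible:
  fixes A :: "'a::{comm_ring, comm_monoid_mult} mat"
  assumes A: "A \<in> carrier_mat n n" and perm: "\<pi> permutes {0..<n}"
  shows "\<exists>B. is_inverse_mat (perm_plus_mat \<pi> A) B"
proof -
  \<comment> \<open>This is A_+ - 1. Its zero diagonal makes each factor of \<open>Q\<close>
    invertible, with inverse given by \<open>- N\<close>.\<close>
  define N where "N = mat n n (\<lambda>(i, j). if inv_into UNIV \<pi> i < inv_into UNIV \<pi> j then A $$ (i, j) else 0)"
  define Q where "Q = ordered_prod_mat n (\<lambda>k. reflection_mat N (\<pi> k))"
  let ?U = "perm_plus_mat \<pi> A"
  have N: "N \<in> carrier_mat n n" "- N \<in> carrier_mat n n" by (auto simp: N_def)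
  interpret N: ordered_reflections N n \<pi>
    using N perm by unfold_locales
  have UN: "perm_plus_mat \<pi> N = ?U"
    using A by (intro eq_matI) (auto simp: perm_plus_mat_def N_def)
  have U: "?U \<in> carrier_mat n n" using A by (rule perm_plus_mat_carrier)
  have Q: "Q \<in> carrier_mat n n"
    using N.partial_prod_carrier[of 0] by (simp add: Q_def N.partial_prod_def suffix_prod_mat_0)
  have UQ: "?U * Q = 1\<^sub>m n"
  proof (rule eq_matI)
    fix i j assume "i < dim_row (1\<^sub>m n :: 'a mat)" "j < dim_col (1\<^sub>m n :: 'a mat)"
    hence ij: "i < n" "j < n" by auto
    thus "(?U * Q) $$ (i, j) = 1\<^sub>m n $$ (i, j)"
      \<comment> \<open>The subtracted term vanishes: \<open>N\<close> is zero wherever the position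
        of \<open>j\<close> is at most that of \<open>i\<close>.\<close>
      using N.perm_plus_mat_mult_prod_index[OF ij] unfolding UN Q_def[symmetric]
      by (simp add: N_def)
  qed (use U Q in auto)
  have "\<exists>Y \<in> carrier_mat n n. Q * Y = 1\<^sub>m n"
    unfolding Q_def suffix_prod_mat_0[symmetric]
  proof (rule suffix_prod_mat_right_inverse)
    fix k assume "k < n"
    thus "reflection_mat N (\<pi> k) * reflection_mat (- N) (\<pi> k) = 1\<^sub>m n"
      using N by (intro reflection_mat_mult_uminus) (auto simp: N_def)
  qed (use N in auto)
  then obtain Y where Y: "Y \<in> carrier_mat n n" "Q * Y = 1\<^sub>m n" by blast
  \<comment> \<open>The right inverse \<open>Y\<close> of \<open>Q\<close> equals its left inverse
    \<open>?U\<close>, which makes \<open>Q\<close> a two-sided inverse of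
    \<open>?U\<close>.\<close>
  have "?U = ?U * (Q * Y)" using Y one_mat_mult_right[OF U] by simp
  also have "\<dots> = Y"
    using assoc_mult_mat[OF U Q Y(1)] UQ one_mat_mult_left[OF Y(1)] by simp
  finally show ?thesis
    unfolding is_inverse_mat_def using U Q UQ Y by auto
qed

theorem corollary2p13:
  fixes A :: "'a::{comm_ring, comm_monoid_mult} mat" and n :: nat and \<pi> :: "nat \<Rightarrow> nat"
  assumes "A \<in> carrier_mat n n"
    and "\<And>i. i < n \<Longrightarrow> A $$ (i, i) = 1 + 1"
    and "\<pi> permutes {0..<n}"
  shows "(\<exists>B. is_inverse_mat (perm_plus_mat \<pi> A) B) \<and>
    ordered_prod_mat n (\<lambda>k. reflection_mat A (\<pi> k)) =
      - (inverse_mat (perm_plus_mat \<pi> A) * transpose_mat (perm_minus_mat \<pi> A))"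
proof -
  interpret ordered_reflections A n \<pi>
    using assms by unfold_locales
  let ?U = "perm_plus_mat \<pi> A" and ?L = "transpose_mat (perm_minus_mat \<pi> A)"
  let ?P = "ordered_prod_mat n (\<lambda>k. reflection_mat A (\<pi> k))"
  obtain B where inv: "is_inverse_mat ?U B"
    using perm_plus_mat_invertible assms by blast
  have U: "?U \<in> carrier_mat n n" using A by (rule perm_plus_mat_carrier)
  have L: "?L \<in> carrier_mat n n" using A by (auto simp: perm_minus_mat_def)
  have P: "?P \<in> carrier_mat n n"
    using partial_prod_carrier[of 0] by (simp add: partial_prod_def suffix_prod_mat_0)
  have B: "B \<in> carrier_mat n n" "B * ?U = 1\<^sub>m n"
    using inv U by (auto simp: is_inverse_mat_def)
  \<comment> \<open>Distinct indices have distinct positions, so off the diagonal the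
    \<open>\<le>\<close> of the product formula agrees with the \<open><\<close> in
    \<open>perm_minus_mat\<close>.\<close>
  have inj: "inv_into UNIV \<pi> i = inv_into UNIV \<pi> j \<longleftrightarrow> i = j" for i j
    by (metis permutes_inverses(1)[OF perm])
  have UP: "?U * ?P = - ?L"
  proof (rule eq_matI)
    fix i j assume "i < dim_row (- ?L)" "j < dim_col (- ?L)"
    hence ij: "i < n" "j < n" using L by auto
    \<comment> \<open>On the diagonal 1 - (1 + 1) = -1. Off it, both sides are -A_ij if
      \<open>j\<close> has the smaller position and 0 otherwise.\<close>
    thus "(?U * ?P) $$ (i, j) = (- ?L) $$ (i, j)"
      using A assms(2)[of i] inj[of i j]
      by (auto simp: perm_plus_mat_mult_prod_index[OF ij] perm_minus_mat_def)
  qed (use U P L in auto)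
  have "?P = B * ?U * ?P" using B one_mat_mult_left[OF P] by simp
  also have "\<dots> = B * - ?L" using assoc_mult_mat[OF B(1) U P] UP by simp
  also have "\<dots> = - (B * ?L)" using B L by simp
  finally show ?thesis
    using inv inverse_mat_eqI[OF inv] by auto
qed

end
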